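(* Let $k$ and $r$ be two integers with $k \ge 2$ and $k \ge r \ge 1$, and let $D$ be a digraph. If $D$ contains no directed cycle whose length is congruent to $r$ modulo $k$, then $\chi_a(D) \le k$.
   Context: Digraphs are finite and contain no loops and no parallel arcs; a pair of opposite arcs $(u,v)$ and $(v,u)$ is allowed. Cycles in digraphs are simple and directed (no repeated vertices); the length of a cycle is its number of arcs, and $u \to v \to u$ is a directed cycle of length $2$ when both arcs $(u,v)$ and $(v,u)$ are present. An acyclic $k$-coloring of a digraph $D$ is an assignment of $k$ colors $1,2,\ldots,k$ to the vertices of $D$ such that each color class induces an acyclic subdigraph of $D$ (one containing no directed cycle). The acyclic chromatic number $\chi_a(D)$ is the minimum $k$ for which $D$ admits an acyclic $k$-coloring. *)

theory Defs
  imports "Graph_Theory.Digraph_Component" "HOL-Number_Theory.Cong"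
begin

text \<open>
  The locale \<^locale>\<open>digraph\<close> describes finite digraphs without loops and without parallel
  arcs; opposite arcs are allowed.  A \<^const>\<open>pre_digraph.cycle\<close> is a nonempty closed directed
  walk, given by its list of arcs, that repeats no vertex
  except that it ends where it starts, so its length is the length of the
  list and a pair of opposite arcs is a cycle of length 2.
\<close>

definition acyclic_digraph :: "('a, 'b) pre_digraph \<Rightarrow> bool" where
  "acyclic_digraph G \<longleftrightarrow> \<not> (\<exists>p. pre_digraph.cycle G p)"

definition acyclic_coloring :: "('a, 'b) pre_digraph \<Rightarrow> nat \<Rightarrow> ('a \<Rightarrow> nat) \<Rightarrow> bool" where
  "acyclic_coloring G k c \<longleftrightarrow>
     c ` verts G \<subseteq> {1..k} \<and>
     (\<forall>i\<in>{1..k}. acyclic_digraph (G \<restriction> {v \<in> verts G. c v = i}))"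

definition acyclic_chromatic_number :: "('a, 'b) pre_digraph \<Rightarrow> nat" where
  "acyclic_chromatic_number G = (LEAST k. \<exists>c. acyclic_coloring G k c)"

text \<open>The minimum is over a nonempty set: an injective coloring is always acyclic.\<close>

lemma (in digraph) ex_acyclic_coloring: "\<exists>k c. acyclic_coloring G k c"
proof -
  obtain f n where f: "f ` verts G = {i::nat. i < n}" "inj_on f (verts G)"
    using finite_imp_inj_to_nat_seg[OF finite_verts] by blast
  have "acyclic_digraph (G \<restriction> {v \<in> verts G. Suc (f v) = i})" for i
    unfolding acyclic_digraph_def
  proof
    assume "\<exists>p. pre_digraph.cycle (G \<restriction> {v \<in> verts G. Suc (f v) = i}) p"
    then obtain p where p: "pre_digraph.cycle (G \<restriction> {v \<in> verts G. Suc (f v) = i}) p" by blast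
    then obtain e where "e \<in> arcs (G \<restriction> {v \<in> verts G. Suc (f v) = i})"
      by (cases p) (auto simp: pre_digraph.cycle_def pre_digraph.awalk_def)
    then have e: "e \<in> arcs G" "Suc (f (tail G e)) = i" "Suc (f (head G e)) = i"
      by (auto simp: induce_subgraph_def)
    then have "tail G e = head G e"
      using f(2) by (auto simp: inj_on_def)
    with e(1) show False using no_loops by blast
  qed
  moreover have "(\<lambda>v. Suc (f v)) ` verts G \<subseteq> {1..n}"
    using f(1) by (fastforce simp: Suc_le_eq)
  ultimately show ?thesis unfolding acyclic_coloring_def by blast
qed

end

theory Submission
  imports Defs
begin

text \<open>
  Colours are integers read modulo \<open>k\<close>.  Starting from an arbitrary colouring, the monochromatic
  cycles are destroyed one by one by recolourings that never create a new one.

  A recolouring adds to the colour of each vertex \<open>v\<close> a natural number \<open>\<phi> v\<close>.  Suppose that no arc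
  along which \<open>\<phi>\<close> strictly decreases is monochromatic afterwards (\<open>\<phi>\<close> is \<^emph>\<open>stable\<close>).  Along a cycle
  that is monochromatic for the new colouring \<open>\<phi>\<close> can then never decrease, so it is constant
  there, and the cycle was already monochromatic for the old colouring.  Moreover a cycle on
  which \<open>\<phi>\<close> is not constant is no longer monochromatic.

  It remains to find, for an arc from \<open>t\<close> to \<open>s\<close> on a monochromatic cycle, a stable \<open>\<phi>\<close> with
  \<open>\<phi> t \<noteq> \<phi> s\<close>.  Start with \<open>\<phi> s = M\<close> and \<open>\<phi> = 0\<close> elsewhere, and as long as some arc from \<open>x\<close> to
  \<open>y\<close> violates stability, raise \<open>\<phi> y\<close> by one.  When \<open>\<phi> y\<close> is raised to \<open>f\<close>, the vertex \<open>y\<close> gets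
  a colour one larger than the current colour of \<open>x\<close>.  Tracing back how \<open>x\<close> obtained its value
  yields a walk from \<open>s\<close> to \<open>y\<close> along which the colours at the times of raising grow by exactly one
  per arc, so its length is determined modulo \<open>k\<close> by \<open>f\<close>.  The values of \<open>\<phi>\<close> reached do not
  increase along this walk, although \<open>\<phi>\<close> only grows with time; hence the walk visits no vertex
  twice.  If \<open>t\<close> were ever raised, the path belonging to its first raise would close up with
  the arc from \<open>t\<close> to \<open>s\<close> to a cycle of length congruent to \<open>2 - M\<close>.  The choice
  \<open>M = k - r + 2\<close> makes this a forbidden length, so that \<open>\<phi> t = 0 \<noteq> M = \<phi> s\<close>.

  The raising process is replaced by an extremal choice: \<open>supported\<close> records the paths that the
  process would have produced, and a supported \<open>\<phi>\<close> with maximal sum is stable.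
\<close>

section \<open>Monochromatic cycles and stable shifts\<close>

context pre_digraph
begin

text \<open>
  Colours are compared arc by arc, which along a cycle forces a single colour; in this form
  the condition transfers directly between two colourings.
\<close>

definition mono_cycles :: "nat \<Rightarrow> ('a \<Rightarrow> int) \<Rightarrow> 'b list set" where
  "mono_cycles k c =
     {p. cycle p \<and> (\<forall>e\<in>set p. [c (tail G e) = c (head G e)] (mod int k))}"

definition stable :: "nat \<Rightarrow> ('a \<Rightarrow> int) \<Rightarrow> ('a \<Rightarrow> nat) \<Rightarrow> bool" where
  "stable k c \<phi> \<longleftrightarrow> (\<forall>e\<in>arcs G. \<phi> (head G e) < \<phi> (tail G e) \<longrightarrow>
     \<not> [c (tail G e) + int (\<phi> (tail G e)) = c (head G e) + int (\<phi> (head G e))] (mod int k))"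

text \<open>
  In terms of the raising process from the source \<open>s\<close>, the path \<open>p\<close> below is the history of the raise
  of \<open>v\<close> to the value \<open>f\<close>.  The lower bound \<open>f\<close> on all its vertices is what keeps these paths
  simple when they are extended.  The source is exempt because it starts at \<open>M\<close> without having
  passed through the smaller values.
\<close>

definition supported :: "nat \<Rightarrow> ('a \<Rightarrow> int) \<Rightarrow> 'a \<Rightarrow> nat \<Rightarrow> ('a \<Rightarrow> nat) \<Rightarrow> bool" where
  "supported k c s M \<phi> \<longleftrightarrow> \<phi> s = M \<and> (\<forall>v. \<phi> v \<le> M) \<and>
     (\<forall>v\<in>verts G - {s}. \<forall>f\<in>{1..\<phi> v}. \<exists>p. apath s p v \<and>
        (\<forall>w\<in>set (awalk_verts s p). f \<le> \<phi> w) \<and>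
        [c s + int M + int (length p) = c v + int f] (mod int k))"

end

context digraph
begin

lemma nondecreasing_along_awalk:
  fixes \<phi> :: "'a \<Rightarrow> nat"
  assumes "awalk u p v" and "\<forall>e\<in>set p. \<phi> (tail G e) \<le> \<phi> (head G e)"
  shows "\<phi> u \<le> \<phi> v \<and> (\<forall>e\<in>set p. \<phi> u \<le> \<phi> (tail G e) \<and> \<phi> (head G e) \<le> \<phi> v)"
  using assms
proof (induction p arbitrary: u)
  case Nil
  then show ?case by (simp add: awalk_Nil_iff)
next
  case (Cons e p)
  then have "u = tail G e" and "awalk (head G e) p v" by (auto simp: awalk_Cons_iff)
  with Cons.IH[of "head G e"] Cons.prems(2) show ?case by fastforce
qed

lemma nondecreasing_on_cycle_imp_constant:
  fixes \<phi> :: "'a \<Rightarrow> nat"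
  assumes "cycle p" and "\<forall>e\<in>set p. \<phi> (tail G e) \<le> \<phi> (head G e)" and "e \<in> set p"
  shows "\<phi> (tail G e) = \<phi> (head G e)"
proof -
  obtain u where "awalk u p u" using assms(1) by (auto simp: cycle_def)
  from nondecreasing_along_awalk[OF this assms(2)] assms(2,3) show ?thesis
    by (meson le_antisym le_trans)
qed

lemma cycle_arcs: "cycle p \<Longrightarrow> set p \<subseteq> arcs G"
  by (auto simp: cycle_def)

lemma mono_cycle_stable_shift:
  assumes "stable k c \<phi>" and p: "p \<in> mono_cycles k (\<lambda>v. c v + int (\<phi> v))"
  shows "p \<in> mono_cycles k c" and "\<And>e. e \<in> set p \<Longrightarrow> \<phi> (tail G e) = \<phi> (head G e)"
proof -
  have cyc: "cycle p" and
    mono: "\<And>e. e \<in> set p \<Longrightarrow>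
      [c (tail G e) + int (\<phi> (tail G e)) = c (head G e) + int (\<phi> (head G e))] (mod int k)"
    using p by (auto simp: mono_cycles_def)
  have "\<forall>e\<in>set p. \<phi> (tail G e) \<le> \<phi> (head G e)"
    using assms(1) mono cycle_arcs[OF cyc] unfolding stable_def by (meson not_le subsetD)
  then show const: "\<phi> (tail G e) = \<phi> (head G e)" if "e \<in> set p" for e
    using nondecreasing_on_cycle_imp_constant[OF cyc] that by blast
  have "[c (tail G e) = c (head G e)] (mod int k)" if "e \<in> set p" for e
    using mono[OF that] unfolding const[OF that] by (simp add: cong_add_rcancel)
  with cyc show "p \<in> mono_cycles k c" by (simp add: mono_cycles_def)
qed

section \<open>Constructing a stable shift\<close>

lemma supported_apath:
  assumes "supported k c s M \<phi>" and "s \<in> verts G" and "v \<in> verts G" and "0 < \<phi> v"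
  obtains p where "apath s p v" and "\<forall>w\<in>set (awalk_verts s p). \<phi> v \<le> \<phi> w"
    and "[c s + int M + int (length p) = c v + int (\<phi> v)] (mod int k)"
proof (cases "v = s")
  case True
  then show ?thesis
    using that[of "[]"] assms(1,2) by (simp add: apath_Nil_iff supported_def)
next
  case False
  then have "v \<in> verts G - {s}" and "\<phi> v \<in> {1..\<phi> v}" using assms(3,4) by auto
  with assms(1) that show ?thesis unfolding supported_def by blast
qed

lemma apath_snoc:
  assumes "apath s p (tail G e)" and "e \<in> arcs G" and "head G e \<notin> set (awalk_verts s p)"
  shows "apath s (p @ [e]) (head G e)"
    and "set (awalk_verts s (p @ [e])) = insert (head G e) (set (awalk_verts s p))"
proof -
  have p: "awalk s p (tail G e)" "distinct (awalk_verts s p)"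
    using assms(1) by (auto simp: apath_def)
  have w: "awalk s (p @ [e]) (head G e)"
    using awalk_appendI[OF p(1) arc_implies_awalk[OF assms(2)]] .
  have "awalk_verts s (p @ [e]) = awalk_verts s p @ [head G e]"
    using awlast_of_awalk[OF p(1)] by (auto simp: awalk_verts_conv split: if_splits)
  with p(2) w assms(3) show "apath s (p @ [e]) (head G e)"
    and "set (awalk_verts s (p @ [e])) = insert (head G e) (set (awalk_verts s p))"
    by (auto simp: apath_def)
qed

text \<open>
  One step of the raising process.  The history of the tail is extended by the violating arc; it
  avoids the head, since all its vertices have values at least that of the tail, which exceeds
  that of the head.
\<close>

lemma supported_raise:
  assumes sup: "supported k c s M \<phi>" and s: "s \<in> verts G" and e: "e \<in> arcs G"
    and less: "\<phi> (head G e) < \<phi> (tail G e)"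
    and cong: "[c (tail G e) + int (\<phi> (tail G e)) = c (head G e) + int (\<phi> (head G e))] (mod int k)"
  shows "supported k c s M (\<phi>(head G e := Suc (\<phi> (head G e))))"
proof -
  define x y where "x = tail G e" and "y = head G e"
  define \<psi> where "\<psi> = \<phi>(y := Suc (\<phi> y))"
  have bound: "\<phi> v \<le> M" for v using sup by (simp add: supported_def)
  have "\<phi> s = M" using sup by (simp add: supported_def)
  then have ys: "y \<noteq> s" using less bound[of x] by (auto simp: x_def y_def)
  have le: "\<phi> v \<le> \<psi> v" for v by (simp add: \<psi>_def)
  have "x \<in> verts G" "0 < \<phi> x" using e less by (auto simp: x_def)
  then obtain p where p: "apath s p x" "\<forall>w\<in>set (awalk_verts s p). \<phi> x \<le> \<phi> w"
      "[c s + int M + int (length p) = c x + int (\<phi> x)] (mod int k)"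
    using supported_apath[OF sup s] by blast
  have "y \<notin> set (awalk_verts s p)" using p(2) less by (auto simp: x_def y_def)
  with p(1) e have q: "apath s (p @ [e]) y"
      "set (awalk_verts s (p @ [e])) = insert y (set (awalk_verts s p))"
    using apath_snoc[of s p e] by (simp_all add: x_def y_def)
  have "\<forall>w\<in>set (awalk_verts s (p @ [e])). Suc (\<phi> y) \<le> \<psi> w"
    using p(2) less unfolding q(2) by (fastforce simp: \<psi>_def x_def y_def)
  moreover have "[c s + int M + int (length (p @ [e])) = c y + int (Suc (\<phi> y))] (mod int k)"
  proof -
    have "[c s + int M + int (length p) = c y + int (\<phi> y)] (mod int k)"
      using p(3) cong unfolding x_def y_def by (rule cong_trans)
    then have "[c s + int M + int (length p) + 1 = c y + int (\<phi> y) + 1] (mod int k)"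
      by (simp add: cong_add_rcancel)
    then show ?thesis by (simp add: algebra_simps)
  qed
  ultimately have new: "\<exists>p. apath s p y \<and> (\<forall>w\<in>set (awalk_verts s p). Suc (\<phi> y) \<le> \<psi> w) \<and>
      [c s + int M + int (length p) = c y + int (Suc (\<phi> y))] (mod int k)"
    using q(1) by blast
  have "\<exists>p. apath s p v \<and> (\<forall>w\<in>set (awalk_verts s p). f \<le> \<psi> w) \<and>
      [c s + int M + int (length p) = c v + int f] (mod int k)"
    if "v \<in> verts G - {s}" "f \<in> {1..\<psi> v}" for v f
    \<comment> \<open>Only the raise itself needs a new path; raising a value keeps the old paths valid.\<close>
  proof (cases "v = y \<and> f = Suc (\<phi> y)")
    case True
    with new show ?thesis by blast
  next
    case False
    with that(2) have "f \<in> {1..\<phi> v}" by (auto simp: \<psi>_def split: if_splits)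
    with sup that(1) obtain p where "apath s p v" "\<forall>w\<in>set (awalk_verts s p). f \<le> \<phi> w"
        "[c s + int M + int (length p) = c v + int f] (mod int k)"
      unfolding supported_def by blast
    with le show ?thesis by (meson le_trans)
  qed
  moreover have "\<psi> s = M" using ys \<open>\<phi> s = M\<close> by (simp add: \<psi>_def)
  moreover have "\<psi> v \<le> M" for v
    using bound[of v] bound[of x] less by (auto simp: \<psi>_def x_def y_def)
  ultimately have "supported k c s M \<psi>" unfolding supported_def by blast
  then show ?thesis by (simp add: \<psi>_def y_def)
qed

lemma ex_stable_supported:
  assumes s: "s \<in> verts G"
  obtains \<phi> where "supported k c s M \<phi>" and "stable k c \<phi>"
proof -
  have "supported k c s M ((\<lambda>_. 0)(s := M))" by (auto simp: supported_def)
  moreover have "sum \<phi> (verts G) < Suc (card (verts G) * M)" if "supported k c s M \<phi>" for \<phi>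
    using sum_bounded_above[of "verts G" \<phi> M] that by (simp add: supported_def)
  ultimately obtain \<phi> where \<phi>: "supported k c s M \<phi>"
      and max: "\<And>\<psi>. supported k c s M \<psi> \<Longrightarrow> sum \<psi> (verts G) \<le> sum \<phi> (verts G)"
    using ex_has_greatest_nat[of "supported k c s M" _ "\<lambda>\<phi>. sum \<phi> (verts G)"] by blast
  have "stable k c \<phi>" unfolding stable_def
  proof (intro ballI impI notI)
    fix e
    assume e: "e \<in> arcs G" and less: "\<phi> (head G e) < \<phi> (tail G e)"
      and "[c (tail G e) + int (\<phi> (tail G e)) = c (head G e) + int (\<phi> (head G e))] (mod int k)"
    then have "sum (\<phi>(head G e := Suc (\<phi> (head G e)))) (verts G) \<le> sum \<phi> (verts G)"
      using max supported_raise[OF \<phi> s] by blast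
    moreover have "sum \<phi> (verts G) < sum (\<phi>(head G e := Suc (\<phi> (head G e)))) (verts G)"
      using e by (intro sum_strict_mono_ex1) (auto intro: bexI[of _ "head G e"])
    ultimately show False by simp
  qed
  with \<phi> that show ?thesis by blast
qed

section \<open>Eliminating all monochromatic cycles\<close>

text \<open>
  A raise of the tail to \<open>1\<close> would leave a path of length congruent to \<open>1 - M\<close> with \<open>M = k - r + 2\<close>,
  because the two ends of the arc have the same colour.  The arc closes it to a cycle of length
  congruent to \<open>2 - M\<close>, that is, to \<open>r\<close>.
\<close>

lemma tail_not_raised:
  assumes no_cycle: "\<not> (\<exists>p. cycle p \<and> [length p = r] (mod k))" and "r \<le> k"
    and sup: "supported k c (head G e) (k - r + 2) \<phi>" and e: "e \<in> arcs G"
    and mono: "[c (tail G e) = c (head G e)] (mod int k)"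
  shows "\<phi> (tail G e) = 0"
proof (rule ccontr)
  assume "\<phi> (tail G e) \<noteq> 0"
  moreover have "tail G e \<in> verts G - {head G e}" using e no_loops by auto
  ultimately obtain p where p: "apath (head G e) p (tail G e)"
      and len: "[c (head G e) + int (k - r + 2) + int (length p) = c (tail G e) + int 1] (mod int k)"
    using sup unfolding supported_def by fastforce
  have "cycle (e # p)"
    using p e by (auto simp: cycle_def apath_def awalk_Cons_iff)
  moreover have "[length (e # p) = r] (mod k)"
  proof -
    have colors: "int k dvd c (tail G e) - c (head G e)"
      using mono by (simp add: cong_iff_dvd_diff)
    have path: "int k dvd c (head G e) + int (k - r + 2) + int (length p) - (c (tail G e) + 1)"
      using len by (simp add: cong_iff_dvd_diff)
    have "int k dvd (c (tail G e) - c (head G e)) +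
        (c (head G e) + int (k - r + 2) + int (length p) - (c (tail G e) + 1)) - int k"
      by (rule dvd_diff[OF dvd_add[OF colors path] dvd_refl])
    also have "\<dots> = int (length (e # p)) - int r"
      using \<open>r \<le> k\<close> by (simp add: of_nat_diff)
    finally show ?thesis by (simp add: cong_iff_dvd_diff flip: cong_int_iff)
  qed
  ultimately show False using no_cycle by blast
qed

text \<open>
  The whole set of monochromatic cycles shrinks, not only one cycle is repaired: a stable shift
  creates no new ones, and the chosen cycle is lost since the shift differs at the ends of one of its arcs.
\<close>

lemma mono_cycles_decrease:
  assumes no_cycle: "\<not> (\<exists>p. cycle p \<and> [length p = r] (mod k))" and "r \<le> k"
    and p: "p \<in> mono_cycles k c"
  shows "\<exists>c'. mono_cycles k c' \<subset> mono_cycles k c"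
proof -
  have "cycle p" using p by (simp add: mono_cycles_def)
  then obtain e where e: "e \<in> set p" by (cases p) (auto simp: cycle_def)
  then have arc: "e \<in> arcs G" using cycle_arcs[OF \<open>cycle p\<close>] by blast
  then obtain \<phi> where sup: "supported k c (head G e) (k - r + 2) \<phi>" and st: "stable k c \<phi>"
    using ex_stable_supported[OF head_in_verts] by blast
  have "[c (tail G e) = c (head G e)] (mod int k)"
    using p e by (simp add: mono_cycles_def)
  then have "\<phi> (tail G e) = 0"
    using tail_not_raised[OF no_cycle \<open>r \<le> k\<close> sup arc] by blast
  moreover have "\<phi> (head G e) = k - r + 2" using sup by (simp add: supported_def)
  ultimately have "\<phi> (tail G e) \<noteq> \<phi> (head G e)" by simp
  then have "p \<notin> mono_cycles k (\<lambda>v. c v + int (\<phi> v))"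
    using mono_cycle_stable_shift(2)[OF st _ e] by blast
  with mono_cycle_stable_shift(1)[OF st] p
  have "mono_cycles k (\<lambda>v. c v + int (\<phi> v)) \<subset> mono_cycles k c" by blast
  then show ?thesis by blast
qed

lemma finite_mono_cycles: "finite (mono_cycles k c)"
proof (rule finite_subset)
  show "mono_cycles k c \<subseteq> {p. set p \<subseteq> arcs G \<and> distinct p}"
    by (auto simp: mono_cycles_def cycle_conv)
  show "finite {p. set p \<subseteq> arcs G \<and> distinct p}"
    by (rule finite_subset_distinct) simp
qed

lemma ex_no_mono_cycles:
  assumes "\<not> (\<exists>p. cycle p \<and> [length p = r] (mod k))" and "r \<le> k"
  shows "\<exists>c. mono_cycles k c = {}"
proof -
  obtain c where min: "\<And>c'. card (mono_cycles k c) \<le> card (mono_cycles k c')"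
    using ex_has_least_nat[of "\<lambda>_. True" undefined "\<lambda>c. card (mono_cycles k c)"] by blast
  have "mono_cycles k c = {}"
  proof (rule ccontr)
    assume "mono_cycles k c \<noteq> {}"
    then obtain c' where "mono_cycles k c' \<subset> mono_cycles k c"
      using mono_cycles_decrease[OF assms] by blast
    then have "card (mono_cycles k c') < card (mono_cycles k c)"
      by (rule psubset_card_mono[OF finite_mono_cycles])
    with min[of c'] show False by simp
  qed
  then show ?thesis by blast
qed

lemma acyclic_coloring_of_no_mono_cycles:
  assumes "mono_cycles k c = {}" and "0 < k"
  shows "acyclic_coloring G k (\<lambda>v. Suc (nat (c v mod int k)))"
  unfolding acyclic_coloring_def acyclic_digraph_def
proof (intro conjI ballI notI)
  have "nat (c v mod int k) < k" for v
    using assms(2) by (simp add: nat_less_iff)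
  then show "(\<lambda>v. Suc (nat (c v mod int k))) ` verts G \<subseteq> {1..k}"
    by (auto simp: Suc_le_eq)
next
  fix i
  let ?S = "{v \<in> verts G. Suc (nat (c v mod int k)) = i}"
  assume "\<exists>p. pre_digraph.cycle (G \<restriction> ?S) p"
  then obtain p where p: "pre_digraph.cycle (G \<restriction> ?S) p" by blast
  have "subgraph (G \<restriction> ?S) G"
    by (intro induced_imp_subgraph induced_induce) auto
  then have "cycle p" using p by (rule subgraph_cycle)
  moreover have "[c (tail G e) = c (head G e)] (mod int k)" if "e \<in> set p" for e
  proof -
    have "e \<in> arcs (G \<restriction> ?S)"
      using p that by (auto simp: pre_digraph.cycle_def pre_digraph.awalk_def)
    then have "nat (c (tail G e) mod int k) = nat (c (head G e) mod int k)" by auto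
    with assms(2) show ?thesis by (simp add: cong_def eq_nat_nat_iff)
  qed
  ultimately have "p \<in> mono_cycles k c" by (simp add: mono_cycles_def)
  with assms(1) show False by simp
qed

end

theorem theorem3:
  fixes D :: "('a, 'b) pre_digraph" and k r :: nat
  assumes "digraph D"
    and "2 \<le> k" and "1 \<le> r" and "r \<le> k"
    and "\<not> (\<exists>p. pre_digraph.cycle D p \<and> [length p = r] (mod k))"
  shows "acyclic_chromatic_number D \<le> k"
proof -
  interpret digraph D by fact
  obtain c where "mono_cycles k c = {}"
    using ex_no_mono_cycles assms(4,5) by blast
  with assms(2) have "acyclic_coloring D k (\<lambda>v. Suc (nat (c v mod int k)))"
    by (intro acyclic_coloring_of_no_mono_cycles) auto
  then show ?thesis
    unfolding acyclic_chromatic_number_def by (intro Least_le exI)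
qed

end
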